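(* Let $G$ be a finite group, $H\le G$ a subgroup, $e\in E^\bullet(H)$ and $w\in\mathbb{C}[G]$ a weight. The left-invariant random walk on $G$ driven by $w$ lumps weakly to $G/H$ with stable ideal $\mathbb{C}[G]e$ if and only if the left-invariant random walk on $G$ driven by $w^\star$ lumps weakly to $G/H$ with stable ideal $\mathbb{C}[G](1-e^\star+\eta_H)$.
   Context: A weight on $G$ is a function $w:G\to\mathbb{R}_{\ge0}$, not identically zero, identified with $\sum_g w(g)g\in\mathbb{C}[G]$. The left-invariant random walk driven by $w$ is the Markov chain on $G$ in which the step $x\mapsto xg$ has probability $w(g)/\sum_{k\in G}w(k)$. For $x=\sum_g x(g)g\in\mathbb{C}[G]$, $x^\star = \sum_{g\in G}\overline{x(g)}\,g^{-1}$. $\eta_H=|H|^{-1}\sum_{h\in H}h$, and $E^\bullet(H)$ is the set of idempotents $e\in\mathbb{C}[H]$ with $\eta_He=\eta_H$. For a left ideal $L=\mathbb{C}[G]e$ with $e\in E^\bullet(H)$, the walk driven by $w$ lumps weakly to $G/H$ with stable ideal $L$ if $ew(1-e)=0$ and $(e-\eta_H)w\eta_H=0$ (equivalently $Lw\subseteq L$ and $L(1-\eta_H)w\eta_H=0$, so this depends only on $L$). *)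

theory Defs
  imports "HOL-Algebra.Ideal" "HOL-Library.Nonpos_Ints" Complex_Main
begin

text \<open>
  An element of \<open>\<complex>[G]\<close> is a function \<open>'a \<Rightarrow> complex\<close> vanishing off the carrier of \<open>G\<close>,
  \<open>x\<close> standing for the formal sum of the \<open>x(g) g\<close>.  The \<open>if\<close> in the convolution keeps
  products in the carrier.  The type of \<open>G\<close> may be infinite; only the carrier is required to be
  finite (without that, the sum in the convolution is meaningless).
\<close>

definition group_algebra :: "('a, 'm) monoid_scheme \<Rightarrow> ('a \<Rightarrow> complex) ring" where
  "group_algebra G =
     \<lparr>carrier = {x. \<forall>g. g \<notin> carrier G \<longrightarrow> x g = 0},
      monoid.mult = (\<lambda>x y g. if g \<in> carrier G
                then \<Sum>h\<in>carrier G. x h * y (inv\<^bsub>G\<^esub> h \<otimes>\<^bsub>G\<^esub> g) else 0),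
      one = (\<lambda>g. if g = \<one>\<^bsub>G\<^esub> then 1 else 0),
      zero = (\<lambda>g. 0),
      add = (\<lambda>x y g. x g + y g)\<rparr>"

definition ga_star :: "('a, 'm) monoid_scheme \<Rightarrow> ('a \<Rightarrow> complex) \<Rightarrow> 'a \<Rightarrow> complex" where
  "ga_star G x = (\<lambda>g. if g \<in> carrier G then cnj (x (inv\<^bsub>G\<^esub> g)) else 0)"

text \<open>The idempotent \<open>\<eta>\<^sub>H\<close>.\<close>

definition avg :: "'a set \<Rightarrow> 'a \<Rightarrow> complex" where
  "avg H = (\<lambda>h. if h \<in> H then 1 / of_nat (card H) else 0)"

text \<open>
  \<open>E\<^sup>\<bullet>(H)\<close>.  Since elements are extended by zero, \<open>\<complex>[H]\<close> literally is a subset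
  of \<open>\<complex>[G]\<close>, and products are taken in \<open>\<complex>[G]\<close>.
\<close>

definition E_bullet :: "('a, 'm) monoid_scheme \<Rightarrow> 'a set \<Rightarrow> ('a \<Rightarrow> complex) set" where
  "E_bullet G H = {e \<in> carrier (group_algebra (G\<lparr>carrier := H\<rparr>)).
     e \<otimes>\<^bsub>group_algebra G\<^esub> e = e \<and> avg H \<otimes>\<^bsub>group_algebra G\<^esub> e = avg H}"

definition weight :: "('a, 'm) monoid_scheme \<Rightarrow> ('a \<Rightarrow> complex) \<Rightarrow> bool" where
  "weight G w \<longleftrightarrow> w \<in> carrier (group_algebra G) \<and>
     (\<forall>g\<in>carrier G. w g \<in> \<real>\<^sub>\<ge>\<^sub>0) \<and> (\<exists>g\<in>carrier G. w g \<noteq> 0)"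

text \<open>
  The transition matrix of the left-invariant random walk: the step from \<open>x\<close> to \<open>y = xg\<close>
  uses \<open>g = x\<^sup>-\<^sup>1 y\<close>.  \<open>Re\<close> loses nothing, as weights take nonnegative real values.
\<close>

definition walk :: "('a, 'm) monoid_scheme \<Rightarrow> ('a \<Rightarrow> complex) \<Rightarrow> 'a \<Rightarrow> 'a \<Rightarrow> real" where
  "walk G w x y = (if x \<in> carrier G \<and> y \<in> carrier G
     then Re (w (inv\<^bsub>G\<^esub> x \<otimes>\<^bsub>G\<^esub> y)) / (\<Sum>k\<in>carrier G. Re (w k)) else 0)"

text \<open>
  Weak lumping to \<open>G/H\<close> with stable ideal \<open>L\<close> is a property of the chain \<open>P\<close> and of the
  left ideal \<open>L\<close>; the weight driving \<open>P\<close> is determined only up to a positive scalar and the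
  generator \<open>e\<close> of \<open>L\<close> is not unique.  Neither choice matters, by
  \<open>lumps_weakly_walk_iff\<close> below.  \<open>PIdl\<close> is the library's \<open>{a \<otimes> e | a. a \<in> carrier R}\<close>,
  which in a non-commutative ring is the principal left ideal.
\<close>

definition lumps_weakly ::
  "('a, 'm) monoid_scheme \<Rightarrow> 'a set \<Rightarrow> ('a \<Rightarrow> 'a \<Rightarrow> real) \<Rightarrow> ('a \<Rightarrow> complex) set \<Rightarrow> bool" where
  "lumps_weakly G H P L \<longleftrightarrow>
     (let A = group_algebra G in
      \<exists>w e. weight G w \<and> P = walk G w \<and> e \<in> E_bullet G H \<and> L = PIdl\<^bsub>A\<^esub> e \<and>
        e \<otimes>\<^bsub>A\<^esub> w \<otimes>\<^bsub>A\<^esub> (\<one>\<^bsub>A\<^esub> \<ominus>\<^bsub>A\<^esub> e) = \<zero>\<^bsub>A\<^esub> \<and>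
        (e \<ominus>\<^bsub>A\<^esub> avg H) \<otimes>\<^bsub>A\<^esub> w \<otimes>\<^bsub>A\<^esub> avg H = \<zero>\<^bsub>A\<^esub>)"

lemma group_algebra_simps:
  "carrier (group_algebra G) = {x. \<forall>g. g \<notin> carrier G \<longrightarrow> x g = 0}"
  "x \<otimes>\<^bsub>group_algebra G\<^esub> y = (\<lambda>g. if g \<in> carrier G
     then \<Sum>h\<in>carrier G. x h * y (inv\<^bsub>G\<^esub> h \<otimes>\<^bsub>G\<^esub> g) else 0)"
  "\<one>\<^bsub>group_algebra G\<^esub> = (\<lambda>g. if g = \<one>\<^bsub>G\<^esub> then 1 else 0)"
  "\<zero>\<^bsub>group_algebra G\<^esub> = (\<lambda>g. 0)"
  "x \<oplus>\<^bsub>group_algebra G\<^esub> y = (\<lambda>g. x g + y g)"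
  by (simp_all add: group_algebra_def)

lemma ring_group_algebra:
  fixes G (structure)
  assumes "group G" "finite (carrier G)"
  shows "ring (group_algebra G)"
proof -
  interpret group G by fact
  show ?thesis
  proof (rule ringI)
    show "abelian_group (group_algebra G)"
    proof (rule abelian_groupI)
      fix x assume "x \<in> carrier (group_algebra G)"
      then show "\<exists>y\<in>carrier (group_algebra G).
          y \<oplus>\<^bsub>group_algebra G\<^esub> x = \<zero>\<^bsub>group_algebra G\<^esub>"
        by (intro bexI[of _ "\<lambda>g. - x g"]) (auto simp: group_algebra_simps)
    qed (auto simp: group_algebra_simps)
    show "Group.monoid (group_algebra G)"
    proof (rule monoidI)
      fix x y z
      assume x: "x \<in> carrier (group_algebra G)"
      have "(\<Sum>k\<in>carrier G. (\<Sum>h\<in>carrier G. x h * y (inv h \<otimes> k)) * z (inv k \<otimes> g)) =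
          (\<Sum>h\<in>carrier G. x h * (\<Sum>k\<in>carrier G. y k * z (inv k \<otimes> (inv h \<otimes> g))))"
        if g: "g \<in> carrier G" for g
      proof -
        have "(\<Sum>k\<in>carrier G. (\<Sum>h\<in>carrier G. x h * y (inv h \<otimes> k)) * z (inv k \<otimes> g)) =
          (\<Sum>h\<in>carrier G. x h * (\<Sum>k\<in>carrier G. y (inv h \<otimes> k) * z (inv k \<otimes> g)))"
          by (simp add: sum_distrib_left sum_distrib_right mult.assoc) (rule sum.swap)
        also have "\<dots> =
          (\<Sum>h\<in>carrier G. x h * (\<Sum>k\<in>carrier G. y k * z (inv k \<otimes> (inv h \<otimes> g))))"
        proof (rule sum.cong[OF refl], rule arg_cong2[where f = "(*)", OF refl])
          fix h assume h: "h \<in> carrier G"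
          have c1: "h \<otimes> (inv h \<otimes> k) = k" and c2: "inv h \<otimes> (h \<otimes> k) = k"
            if "k \<in> carrier G" for k
            using that h by (simp_all add: m_assoc[symmetric])
          have c3: "inv (inv h \<otimes> k) \<otimes> (inv h \<otimes> g) = inv k \<otimes> g"
            if "k \<in> carrier G" for k
            using that g h c1[OF g] by (simp add: inv_mult_group m_assoc)
          show "(\<Sum>k\<in>carrier G. y (inv h \<otimes> k) * z (inv k \<otimes> g)) =
              (\<Sum>k\<in>carrier G. y k * z (inv k \<otimes> (inv h \<otimes> g)))"
            by (rule sum.reindex_bij_witness[where i = "\<lambda>k. h \<otimes> k" and j = "\<lambda>k. inv h \<otimes> k"])
               (use h in \<open>auto simp: c1 c2 c3\<close>)
        qed
        finally show ?thesis .
      qed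
      then show "x \<otimes>\<^bsub>group_algebra G\<^esub> y \<otimes>\<^bsub>group_algebra G\<^esub> z =
          x \<otimes>\<^bsub>group_algebra G\<^esub> (y \<otimes>\<^bsub>group_algebra G\<^esub> z)"
        by (auto simp: group_algebra_simps)
    next
      fix x assume x: "x \<in> carrier (group_algebra G)"
      have "(\<Sum>h\<in>carrier G. (if h = \<one> then 1 else 0) * x (inv h \<otimes> g)) = x g"
        if "g \<in> carrier G" for g
        using that assms(2) by (simp add: if_distrib if_distribR cong: if_cong)
      then show "\<one>\<^bsub>group_algebra G\<^esub> \<otimes>\<^bsub>group_algebra G\<^esub> x = x"
        using x by (auto simp: group_algebra_simps)
      have "(\<Sum>h\<in>carrier G. x h * (if inv h \<otimes> g = \<one> then 1 else 0)) = x g"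
        if g: "g \<in> carrier G" for g
      proof -
        have "(\<Sum>h\<in>carrier G. x h * (if inv h \<otimes> g = \<one> then 1 else 0)) =
            (\<Sum>h\<in>carrier G. if h = g then x h else 0)"
        proof (rule sum.cong[OF refl])
          fix h assume h: "h \<in> carrier G"
          have "inv h \<otimes> g = \<one> \<longleftrightarrow> h = g"
            using g h by (metis inv_solve_left r_one one_closed)
          then show "x h * (if inv h \<otimes> g = \<one> then 1 else 0) = (if h = g then x h else 0)"
            by simp
        qed
        then show ?thesis using g assms(2) by simp
      qed
      then show "x \<otimes>\<^bsub>group_algebra G\<^esub> \<one>\<^bsub>group_algebra G\<^esub> = x"
        using x by (auto simp: group_algebra_simps)
    qed (auto simp: group_algebra_simps)
  qed (auto simp: group_algebra_simps algebra_simps sum.distrib)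
qed

lemma group_algebra_minus:
  fixes G (structure)
  assumes "group G" "finite (carrier G)"
    and "x \<in> carrier (group_algebra G)" "y \<in> carrier (group_algebra G)"
  shows "x \<ominus>\<^bsub>group_algebra G\<^esub> y = (\<lambda>g. x g - y g)"
proof -
  interpret A: ring "group_algebra G" using assms by (intro ring_group_algebra)
  have "\<ominus>\<^bsub>group_algebra G\<^esub> y = (\<lambda>g. - y g)"
    using assms(4) by (intro A.minus_equality) (auto simp: group_algebra_simps)
  then show ?thesis by (simp add: a_minus_def group_algebra_simps)
qed

lemma ring_lumping_aux:
  fixes A (structure)
  assumes "ring A"
    and cl: "e \<in> carrier A" "f \<in> carrier A" "n \<in> carrier A" "w \<in> carrier A"
    and idem: "e \<otimes> e = e" "f \<otimes> f = f" and fn: "f \<otimes> n = n" and I: "PIdl e = PIdl f"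
    and 1: "e \<otimes> w \<otimes> (\<one> \<ominus> e) = \<zero>" and 2: "(e \<ominus> n) \<otimes> w \<otimes> n = \<zero>"
  shows "f \<otimes> w \<otimes> (\<one> \<ominus> f) = \<zero> \<and> (f \<ominus> n) \<otimes> w \<otimes> n = \<zero>"
proof -
  interpret ring A by fact
  have "e \<in> PIdl f" "f \<in> PIdl e"
    using cl idem I unfolding cgenideal_def by (metis (mono_tags, lifting) mem_Collect_eq)+
  then obtain a b where ab: "a \<in> carrier A" "e = a \<otimes> f" "b \<in> carrier A" "f = b \<otimes> e"
    unfolding cgenideal_def by auto
  have ef: "e \<otimes> f = e" using ab idem cl by (metis m_assoc)
  have fe: "f \<otimes> e = f" using ab idem cl by (metis m_assoc)
  have eqI: "x = y" if "x \<oplus> \<ominus> y = \<zero>" "x \<in> carrier A" "y \<in> carrier A" for x y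
    using minus_equality[OF that(1)] that by simp
  have "e \<otimes> w \<oplus> \<ominus> (e \<otimes> w \<otimes> e) = \<zero>"
    using 1 cl by (simp add: minus_eq r_distr r_minus)
  then have ewe: "e \<otimes> w \<otimes> e = e \<otimes> w"
    using cl by (subst eqI[of "e \<otimes> w" "e \<otimes> w \<otimes> e"]) simp_all
  have "e \<otimes> w \<otimes> n \<oplus> \<ominus> (n \<otimes> w \<otimes> n) = \<zero>"
    using 2 cl by (simp add: minus_eq l_distr l_minus)
  then have ewn: "e \<otimes> w \<otimes> n = n \<otimes> w \<otimes> n"
    using cl by (rule_tac eqI) simp_all
  have "f \<otimes> w = f \<otimes> (e \<otimes> w \<otimes> e)"
    using ewe fe cl by (metis m_assoc)
  also have "\<dots> = f \<otimes> w \<otimes> e" using fe cl by (metis m_assoc m_closed)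
  finally have fwe: "f \<otimes> w \<otimes> e = f \<otimes> w" by simp
  then have fwf: "f \<otimes> w \<otimes> f = f \<otimes> w" using ef cl by (metis m_assoc m_closed)
  have "f \<otimes> w \<otimes> n = f \<otimes> (e \<otimes> w \<otimes> n)" using fe cl by (metis m_assoc m_closed)
  also have "\<dots> = n \<otimes> w \<otimes> n" using ewn fn cl by (metis m_assoc m_closed)
  finally have fwn: "f \<otimes> w \<otimes> n = n \<otimes> w \<otimes> n" .
  show ?thesis
    using fwf fwn cl by (simp add: minus_eq r_distr r_minus l_distr l_minus r_neg)
qed

lemma E_bullet_mult_avg:
  fixes G (structure)
  assumes "group G" "finite (carrier G)" "subgroup H G" "e \<in> E_bullet G H"
  shows "e \<otimes>\<^bsub>group_algebra G\<^esub> avg H = avg H"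
proof -
  interpret group G by fact
  interpret H: subgroup H G by fact
  have e0: "e g = 0" if "g \<notin> H" for g
    using assms(4) that by (auto simp: E_bullet_def group_algebra_simps)
  have finH: "finite H" using assms(2) H.subset finite_subset by blast
  have inH: "inv h \<otimes> g \<in> H \<longleftrightarrow> g \<in> H" if "h \<in> H" "g \<in> carrier G" for h g
    by (metis H.m_closed H.m_inv_closed H.mem_carrier inv_closed inv_solve_left m_closed that)
  have restr: "(\<Sum>h\<in>carrier G. x h * y h) = (\<Sum>h\<in>H. x h * y h)"
    if "\<And>g. g \<notin> H \<Longrightarrow> x g = 0" for x y :: "'a \<Rightarrow> complex"
    using that H.subset assms(2) by (intro sum.mono_neutral_right) auto
  have sum: "(\<Sum>h\<in>H. e h) = 1"
  proof -
    have "avg H \<otimes>\<^bsub>group_algebra G\<^esub> e = avg H"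
      using assms(4) by (simp add: E_bullet_def)
    from fun_cong[OF this, of \<one>]
    have "(\<Sum>h\<in>H. avg H h * e (inv h \<otimes> \<one>)) = avg H \<one>"
      by (simp add: group_algebra_simps restr avg_def cong: if_cong)
    then have "(\<Sum>h\<in>H. e (inv h)) / of_nat (card H) = 1 / of_nat (card H)"
      by (simp add: avg_def sum_divide_distrib)
    then have "(\<Sum>h\<in>H. e (inv h)) = 1"
      using finH H.one_closed by (auto simp: card_eq_0_iff simp del: H.one_closed)
    moreover have "(\<Sum>h\<in>H. e (inv h)) = (\<Sum>h\<in>H. e h)"
      by (rule sum.reindex_bij_witness[where i = "\<lambda>h. inv h" and j = "\<lambda>h. inv h"]) auto
    ultimately show ?thesis by simp
  qed
  show ?thesis
  proof
    fix g
    show "(e \<otimes>\<^bsub>group_algebra G\<^esub> avg H) g = avg H g"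
    proof (cases "g \<in> carrier G")
      case True
      have "(\<Sum>h\<in>H. e h * avg H (inv h \<otimes> g)) = (\<Sum>h\<in>H. e h * avg H g)"
        using inH True by (intro sum.cong) (auto simp: avg_def)
      also have "\<dots> = avg H g" by (simp add: sum sum_distrib_right[symmetric])
      finally show ?thesis using True e0 by (simp add: group_algebra_simps restr)
    next
      case False
      then show ?thesis by (auto simp: group_algebra_simps avg_def)
    qed
  qed
qed

lemma walk_eqD:
  fixes G (structure)
  assumes "group G" "finite (carrier G)" "weight G w" "weight G v" "walk G w = walk G v"
  shows "\<exists>c::complex. v = (\<lambda>g. c * w g)"
proof -
  interpret group G by fact
  have sum_pos: "(\<Sum>k\<in>carrier G. Re (u k)) > 0" if "weight G u" for u
  proof -
    obtain g where g: "g \<in> carrier G" "u g \<noteq> 0" using \<open>weight G u\<close> by (auto simp: weight_def)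
    have nn: "Re (u k) \<ge> 0 \<and> Im (u k) = 0" if "k \<in> carrier G" for k
      using \<open>weight G u\<close> that by (auto simp: weight_def complex_nonneg_Reals_iff)
    have "Re (u g) > 0" using nn[OF g(1)] g(2) by (metis complex_eq_iff less_eq_real_def zero_complex.sel)
    then show ?thesis using nn g(1) assms(2) by (intro sum_pos2[of _ g]) auto
  qed
  define W V where "W = (\<Sum>k\<in>carrier G. Re (w k))" and "V = (\<Sum>k\<in>carrier G. Re (v k))"
  have pos: "W > 0" "V > 0" using sum_pos assms by (auto simp: W_def V_def)
  have "v g = of_real (V / W) * w g" for g
  proof (cases "g \<in> carrier G")
    case True
    have "walk G w \<one> g = walk G v \<one> g" using assms by simp
    then have "Re (w g) / W = Re (v g) / V" using True by (simp add: walk_def W_def V_def)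
    then have "Re (v g) = V / W * Re (w g)" using pos by (simp add: field_simps)
    moreover have "Im (v g) = 0" "Im (w g) = 0"
      using assms True by (auto simp: weight_def complex_nonneg_Reals_iff)
    ultimately show ?thesis by (simp add: complex_eq_iff)
  next
    case False
    then show ?thesis using assms by (auto simp: weight_def group_algebra_simps)
  qed
  then show ?thesis by blast
qed

lemma lumps_weakly_walk_iff:
  fixes G (structure)
  assumes "group G" "finite (carrier G)" "subgroup H G" "weight G w" "e \<in> E_bullet G H"
  defines "A \<equiv> group_algebra G"
  shows "lumps_weakly G H (walk G w) (PIdl\<^bsub>A\<^esub> e) \<longleftrightarrow>
    e \<otimes>\<^bsub>A\<^esub> w \<otimes>\<^bsub>A\<^esub> (\<one>\<^bsub>A\<^esub> \<ominus>\<^bsub>A\<^esub> e) = \<zero>\<^bsub>A\<^esub> \<and>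
    (e \<ominus>\<^bsub>A\<^esub> avg H) \<otimes>\<^bsub>A\<^esub> w \<otimes>\<^bsub>A\<^esub> avg H = \<zero>\<^bsub>A\<^esub>"
    (is "_ \<longleftrightarrow> ?C w e")
proof
  interpret A: ring A unfolding A_def using assms by (intro ring_group_algebra)
  interpret H: subgroup H G by fact
  have E: "f \<in> carrier A" "f \<otimes>\<^bsub>A\<^esub> f = f" "f \<otimes>\<^bsub>A\<^esub> avg H = avg H" if "f \<in> E_bullet G H" for f
  proof -
    have "e' \<in> carrier A" if "e' \<in> carrier (group_algebra (G\<lparr>carrier := H\<rparr>))" for e'
      using that H.subset by (auto simp: A_def group_algebra_simps)
    then show "f \<in> carrier A" "f \<otimes>\<^bsub>A\<^esub> f = f"
      using that by (auto simp: E_bullet_def A_def)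
    show "f \<otimes>\<^bsub>A\<^esub> avg H = avg H"
      using E_bullet_mult_avg[OF assms(1-3) that] by (simp add: A_def)
  qed
  have n: "avg H \<in> carrier A"
    using H.subset by (auto simp: A_def group_algebra_simps avg_def)
  assume "lumps_weakly G H (walk G w) (PIdl\<^bsub>A\<^esub> e)"
  then obtain v f where vf: "weight G v" "walk G v = walk G w" "f \<in> E_bullet G H"
      "PIdl\<^bsub>A\<^esub> f = PIdl\<^bsub>A\<^esub> e" "?C v f"
    unfolding lumps_weakly_def Let_def A_def by metis
  obtain c where c: "w = (\<lambda>g. c * v g)"
    using walk_eqD[OF assms(1,2) vf(1) assms(4) vf(2)] by blast
  have scale: "x \<otimes>\<^bsub>A\<^esub> w \<otimes>\<^bsub>A\<^esub> y = (\<lambda>g. c * (x \<otimes>\<^bsub>A\<^esub> v \<otimes>\<^bsub>A\<^esub> y) g)" for x y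
    by (auto simp: A_def group_algebra_simps c sum_distrib_left sum_distrib_right ac_simps)
  have "?C w f" using vf(5) unfolding scale by (simp add: A_def group_algebra_simps)
  moreover have "w \<in> carrier A" using assms by (simp add: weight_def)
  ultimately show "?C w e"
    using ring_lumping_aux[OF A.ring_axioms E(1)[OF vf(3)] E(1)[OF assms(5)] n _
        E(2)[OF vf(3)] E(2,3)[OF assms(5)] vf(4)] by blast
next
  assume "?C w e"
  then show "lumps_weakly G H (walk G w) (PIdl\<^bsub>A\<^esub> e)"
    using assms unfolding lumps_weakly_def Let_def A_def by blast
qed

end

theory Submission
  imports Defs
begin

text \<open>
  The map \<open>\<star>\<close> is a conjugate-linear anti-automorphism of \<open>\<complex>[G]\<close>, an involution, and it fixes
  \<open>\<eta> = \<eta>\<^sub>H\<close>.  Put \<open>f = 1 - e\<^sup>\<star> + \<eta>\<close>.  Since \<open>\<eta>e = e\<eta> = \<eta>\<close>, the element \<open>e\<^sup>\<star> - \<eta>\<close> is an idempotent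
  killed by \<open>\<eta>\<close>, so \<open>f\<close> lies in \<open>E\<^sup>\<bullet>(H)\<close>.  Applying \<open>\<star>\<close> to the two lumping conditions for
  \<open>(w\<^sup>\<star>, f)\<close>, and using \<open>(1 - f)\<^sup>\<star> = e - \<eta>\<close> and \<open>(f - \<eta>)\<^sup>\<star> = 1 - e\<close>, turns them into
  \<open>(e - \<eta>)w(1 - e + \<eta>) = 0\<close> and \<open>\<eta>w(1 - e) = 0\<close>.

  It remains to compare these with the conditions \<open>ew(1 - e) = 0\<close> and \<open>(e - \<eta>)w\<eta> = 0\<close> for
  \<open>(w, e)\<close>, which is pure ring theory.  Call the four products \<open>s\<close>, \<open>r\<close> and \<open>p\<close>, \<open>q\<close>.  Then
  \<open>r = \<eta>p\<close>, \<open>q = s\<eta>\<close> and \<open>s + r = p + q\<close>, so \<open>p\<close> and \<open>q\<close> both vanish exactly when \<open>s\<close> and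
  \<open>r\<close> do (\<open>lumping_conditions_dual\<close>).
\<close>

text \<open>
  For \<open>n = \<eta>\<close>, the right-hand conditions are what \<open>\<star>\<close> makes of the lumping conditions for
  \<open>(w\<^sup>\<star>, 1 - e\<^sup>\<star> + \<eta>)\<close>.
\<close>

lemma (in ring) lumping_conditions_dual:
  assumes cl: "e \<in> carrier R" "n \<in> carrier R" "w \<in> carrier R"
    and ne: "n \<otimes> e = n" and en: "e \<otimes> n = n" and nn: "n \<otimes> n = n"
  shows "e \<otimes> w \<otimes> (\<one> \<ominus> e) = \<zero> \<and> (e \<ominus> n) \<otimes> w \<otimes> n = \<zero> \<longleftrightarrow>
    (e \<ominus> n) \<otimes> w \<otimes> (\<one> \<ominus> e \<oplus> n) = \<zero> \<and> n \<otimes> w \<otimes> (\<one> \<ominus> e) = \<zero>"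
    (is "?p = \<zero> \<and> ?q = \<zero> \<longleftrightarrow> ?s = \<zero> \<and> ?r = \<zero>")
proof -
  have r: "n \<otimes> ?p = ?r"
    using cl ne by (metis m_assoc m_closed minus_closed one_closed)
  have "(\<one> \<ominus> e \<oplus> n) \<otimes> n = n"
    using cl en nn by (simp add: minus_eq l_distr l_minus r_neg)
  then have q: "?s \<otimes> n = ?q"
    using cl by (simp add: m_assoc)
  let ?u = "(e \<ominus> n) \<otimes> w \<otimes> (\<one> \<ominus> e)"
  have s: "?s = ?u \<oplus> ?q"
    using cl by (simp add: r_distr)
  have p: "?u \<oplus> ?r = ?p"
  proof -
    have "e \<ominus> n \<oplus> n = e" using cl by (simp add: minus_eq a_assoc l_neg)
    then show ?thesis using cl by (simp add: l_distr[symmetric])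
  qed
  have "x \<oplus> y \<oplus> z = x \<oplus> z \<oplus> y" if "x \<in> carrier R" "y \<in> carrier R" "z \<in> carrier R" for x y z
    using that by (simp add: a_ac)
  from this[of ?u ?q ?r] have sum: "?s \<oplus> ?r = ?p \<oplus> ?q"
    unfolding s p using cl by simp
  show ?thesis
  proof
    assume pq: "?p = \<zero> \<and> ?q = \<zero>"
    then have "?r = \<zero>" using r cl by simp
    then show "?s = \<zero> \<and> ?r = \<zero>" using sum pq cl by simp
  next
    assume sr: "?s = \<zero> \<and> ?r = \<zero>"
    then have "?q = \<zero>" using q cl by simp
    then show "?p = \<zero> \<and> ?q = \<zero>" using sum sr cl by simp
  qed
qed

lemma (in group) ga_star_closed: "ga_star G x \<in> carrier (group_algebra G)"
  by (simp add: ga_star_def group_algebra_simps)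

lemma (in group) ga_star_ga_star:
  "x \<in> carrier (group_algebra G) \<Longrightarrow> ga_star G (ga_star G x) = x"
  by (auto simp: ga_star_def group_algebra_simps)

lemma (in group) ga_star_zero_iff:
  assumes "x \<in> carrier (group_algebra G)"
  shows "ga_star G x = \<zero>\<^bsub>group_algebra G\<^esub> \<longleftrightarrow> x = \<zero>\<^bsub>group_algebra G\<^esub>"
proof -
  have "ga_star G \<zero>\<^bsub>group_algebra G\<^esub> = \<zero>\<^bsub>group_algebra G\<^esub>"
    by (auto simp: ga_star_def group_algebra_simps)
  then show ?thesis using ga_star_ga_star[OF assms] by metis
qed

lemma (in group) ga_star_mult:
  "ga_star G (x \<otimes>\<^bsub>group_algebra G\<^esub> y) = ga_star G y \<otimes>\<^bsub>group_algebra G\<^esub> ga_star G x"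
proof
  fix g
  show "ga_star G (x \<otimes>\<^bsub>group_algebra G\<^esub> y) g =
    (ga_star G y \<otimes>\<^bsub>group_algebra G\<^esub> ga_star G x) g"
  proof (cases "g \<in> carrier G")
    case g: True
    have c: "g \<otimes> (inv g \<otimes> h) = h" "inv g \<otimes> (g \<otimes> h) = h" if "h \<in> carrier G" for h
      using that g by (simp_all add: m_assoc[symmetric])
    \<comment> \<open>The factorisation \<open>g\<^sup>-\<^sup>1 = h k\<close> corresponds to \<open>g = k\<^sup>-\<^sup>1 h\<^sup>-\<^sup>1\<close>, where \<open>k\<^sup>-\<^sup>1 = g h\<close>.\<close>
    have "(\<Sum>h\<in>carrier G. cnj (x h) * cnj (y (inv h \<otimes> inv g))) =
      (\<Sum>k\<in>carrier G. cnj (y (inv k)) * cnj (x (inv (inv k \<otimes> g))))"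
      by (rule sum.reindex_bij_witness[where i = "\<lambda>k. inv g \<otimes> k" and j = "\<lambda>h. g \<otimes> h"])
         (use g in \<open>auto simp: c inv_mult_group m_assoc\<close>)
    then show ?thesis
      using g by (simp add: ga_star_def group_algebra_simps)
  qed (simp add: ga_star_def group_algebra_simps)
qed

lemma (in group) ga_star_avg:
  assumes "subgroup H G"
  shows "ga_star G (avg H) = avg H"
proof -
  interpret H: subgroup H G by fact
  have "inv g \<in> H \<longleftrightarrow> g \<in> H" if "g \<in> carrier G" for g
    using that by (metis H.m_inv_closed inv_inv)
  then show ?thesis by (auto simp: ga_star_def avg_def)
qed

lemma (in group) avg_idem:
  assumes "finite (carrier G)" "subgroup H G"
  shows "avg H \<otimes>\<^bsub>group_algebra G\<^esub> avg H = avg H"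
proof
  interpret H: subgroup H G by fact
  have "finite H" using assms(1) H.subset finite_subset by blast
  then have H0: "card H \<noteq> 0" using H.one_closed by (auto simp del: H.one_closed)
  fix g
  show "(avg H \<otimes>\<^bsub>group_algebra G\<^esub> avg H) g = avg H g"
  proof (cases "g \<in> carrier G")
    case g: True
    have "inv h \<otimes> g \<in> H \<longleftrightarrow> g \<in> H" if "h \<in> H" for h
      using that g
      by (metis H.m_closed H.m_inv_closed H.mem_carrier inv_closed inv_solve_left m_closed)
    then have "(\<Sum>h\<in>H. avg H h * avg H (inv h \<otimes> g)) = (\<Sum>h\<in>H. 1 / of_nat (card H) * avg H g)"
      by (intro sum.cong) (auto simp: avg_def)
    also have "\<dots> = avg H g" using H0 by simp
    finally have "(\<Sum>h\<in>H. avg H h * avg H (inv h \<otimes> g)) = avg H g" .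
    moreover have "(\<Sum>h\<in>carrier G. avg H h * avg H (inv h \<otimes> g)) =
        (\<Sum>h\<in>H. avg H h * avg H (inv h \<otimes> g))"
      using H.subset assms(1) by (intro sum.mono_neutral_right) (auto simp: avg_def)
    ultimately show ?thesis using g by (simp add: group_algebra_simps)
  qed (auto simp: group_algebra_simps avg_def)
qed

lemma (in group) weight_ga_star:
  assumes "weight G w"
  shows "weight G (ga_star G w)"
proof -
  obtain g where "g \<in> carrier G" "w g \<noteq> 0" using assms by (auto simp: weight_def)
  then have "\<exists>g\<in>carrier G. ga_star G w g \<noteq> 0"
    by (intro bexI[of _ "inv g"]) (auto simp: ga_star_def)
  moreover have "ga_star G w g \<in> \<real>\<^sub>\<ge>\<^sub>0" if "g \<in> carrier G" for g
    using assms that by (auto simp: weight_def ga_star_def complex_nonneg_Reals_iff)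
  ultimately show ?thesis using ga_star_closed by (auto simp: weight_def)
qed

text \<open>
  If \<open>d\<close> is an idempotent with \<open>\<eta>d = 0\<close>, then \<open>1 - d\<close> is an idempotent with \<open>\<eta>(1 - d) = \<eta>\<close>;
  here \<open>d = e\<^sup>\<star> - \<eta>\<close>.
\<close>

lemma (in group) dual_idempotent_in_E_bullet:
  assumes fin: "finite (carrier G)" and H: "subgroup H G" and e: "e \<in> E_bullet G H"
  shows "\<one>\<^bsub>group_algebra G\<^esub> \<ominus>\<^bsub>group_algebra G\<^esub> ga_star G e \<oplus>\<^bsub>group_algebra G\<^esub> avg H
    \<in> E_bullet G H"
proof -
  define A where "A = group_algebra G"
  define d n f where "d = ga_star G e" and "n = avg H" and "f = \<one>\<^bsub>A\<^esub> \<ominus>\<^bsub>A\<^esub> d \<oplus>\<^bsub>A\<^esub> n"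
  interpret H: subgroup H G by fact
  interpret A: ring A unfolding A_def using fin by (intro ring_group_algebra is_group)
  have d: "d \<in> carrier A" by (simp add: d_def A_def ga_star_closed)
  have n: "n \<in> carrier A" using H.subset by (auto simp: n_def A_def group_algebra_simps avg_def)
  have dd: "d \<otimes>\<^bsub>A\<^esub> d = d" and dn: "d \<otimes>\<^bsub>A\<^esub> n = n" and nd: "n \<otimes>\<^bsub>A\<^esub> d = n"
    using ga_star_mult[of e e] ga_star_mult[of "avg H" e] ga_star_mult[of e "avg H"] ga_star_avg[OF H]
      E_bullet_mult_avg[OF is_group fin H e] e
    by (auto simp: E_bullet_def d_def n_def A_def)
  have nn: "n \<otimes>\<^bsub>A\<^esub> n = n" using avg_idem[OF fin H] by (simp add: A_def n_def)
  have f: "f \<in> carrier A" using d n by (simp add: f_def)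
  have nf: "n \<otimes>\<^bsub>A\<^esub> f = n"
    using d n nd nn by (simp add: f_def A.minus_eq A.r_distr A.r_minus A.r_neg)
  have df: "d \<otimes>\<^bsub>A\<^esub> f = n"
    using d n dn dd by (simp add: f_def A.minus_eq A.r_distr A.r_minus A.r_neg)
  have "f \<otimes>\<^bsub>A\<^esub> f = f \<ominus>\<^bsub>A\<^esub> d \<otimes>\<^bsub>A\<^esub> f \<oplus>\<^bsub>A\<^esub> n \<otimes>\<^bsub>A\<^esub> f"
    using d n f by (subst (1) f_def) (simp add: A.minus_eq A.l_distr A.l_minus)
  also have "\<dots> = f" using f n by (simp add: nf df A.minus_eq A.a_assoc A.l_neg)
  finally have ff: "f \<otimes>\<^bsub>A\<^esub> f = f" .
  have "f g = 0" if "g \<notin> H" for g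
  proof -
    have "inv g \<notin> H" if "g \<in> carrier G"
      using \<open>g \<notin> H\<close> that by (metis H.m_inv_closed inv_inv)
    then have "d g = 0"
      using e by (auto simp: d_def ga_star_def E_bullet_def group_algebra_simps)
    moreover have "g \<noteq> \<one>" using that by auto
    ultimately show ?thesis
      using that d
      by (simp add: f_def A_def group_algebra_minus[OF is_group fin] A.one_closed[unfolded A_def])
         (simp add: group_algebra_simps n_def avg_def)
  qed
  then have "f \<in> E_bullet G H"
    using ff nf by (simp add: E_bullet_def group_algebra_simps(1)) (simp add: A_def n_def)
  then show ?thesis by (simp add: f_def A_def d_def n_def)
qed

theorem theorem1p9:
  fixes G :: "('a, 'm) monoid_scheme" and H :: "'a set" and e w :: "'a \<Rightarrow> complex"
  assumes "group G" and "finite (carrier G)" and "subgroup H G"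
    and "e \<in> E_bullet G H" and "weight G w"
  shows "lumps_weakly G H (walk G w) (PIdl\<^bsub>group_algebra G\<^esub> e) \<longleftrightarrow>
    lumps_weakly G H (walk G (ga_star G w))
      (PIdl\<^bsub>group_algebra G\<^esub>
        (\<one>\<^bsub>group_algebra G\<^esub> \<ominus>\<^bsub>group_algebra G\<^esub> ga_star G e
          \<oplus>\<^bsub>group_algebra G\<^esub> avg H))"
proof -
  interpret group G by fact
  interpret H: subgroup H G by fact
  define A where "A = group_algebra G"
  define n f where "n = avg H" and "f = \<one>\<^bsub>A\<^esub> \<ominus>\<^bsub>A\<^esub> ga_star G e \<oplus>\<^bsub>A\<^esub> n"
  interpret A: ring A unfolding A_def using assms by (intro ring_group_algebra)
  have minus: "x \<ominus>\<^bsub>A\<^esub> y = (\<lambda>g. x g - y g)" if "x \<in> carrier A" "y \<in> carrier A" for x y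
    using group_algebra_minus[OF assms(1,2)] that by (simp add: A_def)
  have e: "e \<in> carrier A"
    using assms(4) H.subset by (auto simp: E_bullet_def A_def group_algebra_simps)
  have w: "w \<in> carrier A" using assms(5) by (simp add: weight_def A_def)
  have n: "n \<in> carrier A" using H.subset by (auto simp: n_def A_def group_algebra_simps avg_def)
  have star: "ga_star G x \<in> carrier A" for x by (simp add: A_def ga_star_closed)
  have f: "f \<in> carrier A" using n star by (simp add: f_def)
  have f_eq: "f = (\<lambda>g. \<one>\<^bsub>A\<^esub> g - ga_star G e g + n g)"
    using minus[OF A.one_closed star] by (simp add: f_def) (simp add: A_def group_algebra_simps)
  have star_n: "ga_star G n = n" using ga_star_avg assms(3) by (simp add: n_def)
  have star_one: "ga_star G \<one>\<^bsub>A\<^esub> = \<one>\<^bsub>A\<^esub>"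
    by (auto simp: A_def ga_star_def group_algebra_simps)
  have star_mult: "ga_star G (x \<otimes>\<^bsub>A\<^esub> y \<otimes>\<^bsub>A\<^esub> z) = ga_star G z \<otimes>\<^bsub>A\<^esub> ga_star G y \<otimes>\<^bsub>A\<^esub> ga_star G x"
    if "x \<in> carrier A" "y \<in> carrier A" "z \<in> carrier A" for x y z
    using star ga_star_mult by (simp add: A_def[symmetric] A.m_assoc)
  have one_f: "\<one>\<^bsub>A\<^esub> \<ominus>\<^bsub>A\<^esub> f = ga_star G (e \<ominus>\<^bsub>A\<^esub> n)"
  proof -
    have "ga_star G (e \<ominus>\<^bsub>A\<^esub> n) = (\<lambda>g. ga_star G e g - ga_star G n g)"
      using e n by (auto simp: minus ga_star_def)
    then show ?thesis using f star_n by (simp add: minus) (simp add: f_eq)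
  qed
  have f_n: "f \<ominus>\<^bsub>A\<^esub> n = ga_star G (\<one>\<^bsub>A\<^esub> \<ominus>\<^bsub>A\<^esub> e)"
  proof -
    have "ga_star G (\<one>\<^bsub>A\<^esub> \<ominus>\<^bsub>A\<^esub> e) = (\<lambda>g. ga_star G \<one>\<^bsub>A\<^esub> g - ga_star G e g)"
      using e by (auto simp: minus ga_star_def)
    then show ?thesis using f n star_one by (simp add: minus) (simp add: f_eq)
  qed
  have f_star: "f = ga_star G (\<one>\<^bsub>A\<^esub> \<ominus>\<^bsub>A\<^esub> e \<oplus>\<^bsub>A\<^esub> n)"
  proof -
    have "ga_star G (\<one>\<^bsub>A\<^esub> \<ominus>\<^bsub>A\<^esub> e \<oplus>\<^bsub>A\<^esub> n) =
        (\<lambda>g. ga_star G (\<one>\<^bsub>A\<^esub> \<ominus>\<^bsub>A\<^esub> e) g + ga_star G n g)"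
      by (auto simp: ga_star_def A_def group_algebra_simps(5))
    then show ?thesis using f n star_n by (simp add: f_n[symmetric] minus)
  qed
  have s: "f \<otimes>\<^bsub>A\<^esub> ga_star G w \<otimes>\<^bsub>A\<^esub> (\<one>\<^bsub>A\<^esub> \<ominus>\<^bsub>A\<^esub> f) = \<zero>\<^bsub>A\<^esub> \<longleftrightarrow>
      (e \<ominus>\<^bsub>A\<^esub> n) \<otimes>\<^bsub>A\<^esub> w \<otimes>\<^bsub>A\<^esub> (\<one>\<^bsub>A\<^esub> \<ominus>\<^bsub>A\<^esub> e \<oplus>\<^bsub>A\<^esub> n) = \<zero>\<^bsub>A\<^esub>"
    using ga_star_zero_iff[folded A_def, of "(e \<ominus>\<^bsub>A\<^esub> n) \<otimes>\<^bsub>A\<^esub> w \<otimes>\<^bsub>A\<^esub> (\<one>\<^bsub>A\<^esub> \<ominus>\<^bsub>A\<^esub> e \<oplus>\<^bsub>A\<^esub> n)"] e n w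
    by (simp add: one_f star_mult f_star[symmetric])
  have r: "(f \<ominus>\<^bsub>A\<^esub> n) \<otimes>\<^bsub>A\<^esub> ga_star G w \<otimes>\<^bsub>A\<^esub> n = \<zero>\<^bsub>A\<^esub> \<longleftrightarrow>
      n \<otimes>\<^bsub>A\<^esub> w \<otimes>\<^bsub>A\<^esub> (\<one>\<^bsub>A\<^esub> \<ominus>\<^bsub>A\<^esub> e) = \<zero>\<^bsub>A\<^esub>"
    using ga_star_zero_iff[folded A_def, of "n \<otimes>\<^bsub>A\<^esub> w \<otimes>\<^bsub>A\<^esub> (\<one>\<^bsub>A\<^esub> \<ominus>\<^bsub>A\<^esub> e)"] e n w
    by (simp add: f_n star_mult star_n)
  have "n \<otimes>\<^bsub>A\<^esub> e = n" "e \<otimes>\<^bsub>A\<^esub> n = n" "n \<otimes>\<^bsub>A\<^esub> n = n"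
    using assms(4) E_bullet_mult_avg[OF assms(1-4)] avg_idem[OF assms(2,3)]
    by (auto simp: E_bullet_def A_def n_def)
  note dual = A.lumping_conditions_dual[OF e n w this]
  have "f \<in> E_bullet G H"
    using dual_idempotent_in_E_bullet[OF assms(2-4)] by (simp add: f_def A_def n_def)
  from lumps_weakly_walk_iff[OF assms(1-3) weight_ga_star[OF assms(5)] this, folded A_def n_def]
  have "lumps_weakly G H (walk G (ga_star G w)) (PIdl\<^bsub>A\<^esub> f) \<longleftrightarrow>
      lumps_weakly G H (walk G w) (PIdl\<^bsub>A\<^esub> e)"
    using lumps_weakly_walk_iff[OF assms(1-3,5,4), folded A_def n_def] dual s r by simp
  then show ?thesis by (simp add: f_def A_def n_def)
qed

end
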